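(* Let $\mathcal{F}$ be a family of meromorphic functions on an open set $D\subseteq\mathbb{C}$, let $z_0\in D$, and let $E\subseteq\mathbb{C}_\infty$ be a set with empty interior. If $\mathcal{F}$ is expanding at $z_0$ with respect to $\mathbb{C}_\infty\setminus E$, then $\mathcal{F}$ is topologically transitive at $z_0$.
   Context: $\mathbb{C}_\infty$ is the extended complex plane (Riemann sphere), and meromorphic functions on $D$ are regarded as continuous maps $D\to\mathbb{C}_\infty$. A family $\mathcal{F}$ of meromorphic functions on $D$ is expanding at $z_0\in D$ with respect to a set $A\subseteq\mathbb{C}_\infty$ if for every open neighbourhood $U$ of $z_0$ (in $D$) and every compact set $K\subseteq A$ we have $K\subseteq f(U)$ for infinitely many $f\in\mathcal{F}$. The family $\mathcal{F}$ is topologically transitive at $z_0$ if for every open set $U\subseteq D$ containing $z_0$ and every non-empty open set $V\subseteq\mathbb{C}_\infty$ there exists $f\in\mathcal{F}$ with $f(U)\cap V\neq\emptyset$. *)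

theory Defs
  imports "HOL-Complex_Analysis.Complex_Analysis"
begin

text \<open>
  The extended complex plane is the one-point compactification of the plane, with
  \<open>None\<close> as the point at infinity.
\<close>

abbreviation Riemann_sphere :: "complex option topology" where
  "Riemann_sphere \<equiv> Alexandroff_compactification euclidean"

lemma topspace_Riemann_sphere: "topspace Riemann_sphere = UNIV"
  by (simp add: UNIV_option_conv)

definition sphere_map :: "(complex \<Rightarrow> complex) \<Rightarrow> complex \<Rightarrow> complex option" where
  "sphere_map g z = (if is_pole g z then None else Some (g z))"

text \<open>
  The library's \<open>meromorphic_on\<close> leaves values at removable singularities unconstrained;
  \<open>nicely_meromorphic_on\<close> demands the limit value there, which is what makes the sphere-valued
  map continuous. The restriction to \<open>D\<close> makes maps that agree on \<open>D\<close> equal, so that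
  ``infinitely many members'' of a family counts maps on \<open>D\<close>. The constant \<open>None\<close> is
  not a meromorphic map.
\<close>

definition meromorphic_maps :: "complex set \<Rightarrow> (complex \<Rightarrow> complex option) set" where
  "meromorphic_maps D = {restrict (sphere_map g) D | g. g nicely_meromorphic_on D}"

lemma continuous_map_meromorphic_maps:
  assumes "open D" and "f \<in> meromorphic_maps D"
  shows "continuous_map (top_of_set D) Riemann_sphere f"
proof -
  obtain g where g: "g nicely_meromorphic_on D" and f: "f = restrict (sphere_map g) D"
    using assms(2) by (auto simp: meromorphic_maps_def)
  have nhds: "\<forall>\<^sub>F w in nhds z. w \<in> D \<and> f w \<in> W"
    if W: "openin Riemann_sphere W" and z: "z \<in> D" "f z \<in> W" for z W
  proof -
    have D: "\<forall>\<^sub>F w in nhds z. w \<in> D"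
      using assms(1) z(1) by (rule eventually_nhds_in_open)
    have "\<forall>\<^sub>F w in nhds z. sphere_map g w \<in> W"
    proof (cases "is_pole g z")
      case True
      then have "None \<in> W"
        using z by (simp add: f sphere_map_def)
      then obtain C where C: "compact C" "W = insert None (Some ` (- C))"
        using W by (auto simp: openin_Alexandroff_compactification Compl_eq_Diff_UNIV)
      obtain B where B: "\<forall>w\<in>C. norm w \<le> B"
        using compact_imp_bounded[OF C(1)] by (auto simp: bounded_iff)
      have "w \<notin> C" if "B + 1 \<le> norm w" for w
        using B that by fastforce
      then have "\<forall>\<^sub>F w in at_infinity. w \<notin> C"
        unfolding eventually_at_infinity by blast
      then have "\<forall>\<^sub>F w in at z. g w \<notin> C"
        using True unfolding is_pole_def filterlim_iff by blast
      then have "\<forall>\<^sub>F w in at z. sphere_map g w \<in> W"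
        by eventually_elim (auto simp: sphere_map_def C(2))
      moreover have "sphere_map g z \<in> W"
        using z by (simp add: f)
      ultimately show ?thesis
        by (simp add: eventually_nhds_conv_at)
    next
      case False
      then have an: "g analytic_on {z}"
        using nicely_meromorphic_on_imp_analytic_at[OF g z(1)] by blast
      define V where "V = {w. Some w \<in> W}"
      have "open V"
        using openin_continuous_map_preimage[OF continuous_map_Some[of euclidean] W]
        by (simp add: V_def)
      moreover have "g z \<in> V"
        using z False by (simp add: f sphere_map_def V_def)
      ultimately have "\<forall>\<^sub>F w in nhds z. g w \<in> V"
        using analytic_at_imp_isCont[OF an]
        unfolding isCont_def tendsto_at_iff_tendsto_nhds by (blast intro: topological_tendstoD)
      moreover have "\<forall>\<^sub>F w in nhds z. g analytic_on {w}"
        using an unfolding analytic_at eventually_nhds by blast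
      ultimately show ?thesis
        by eventually_elim
           (auto simp: sphere_map_def V_def dest: analytic_at_imp_no_pole)
    qed
    with D show ?thesis
      by eventually_elim (simp add: f)
  qed
  show ?thesis
    unfolding continuous_map_def topspace_Riemann_sphere
  proof (intro conjI allI impI)
    fix W assume "openin Riemann_sphere W"
    then have "\<exists>T. open T \<and> z \<in> T \<and> T \<subseteq> {z \<in> D. f z \<in> W}"
      if "z \<in> D" "f z \<in> W" for z
      using nhds[of W z] that by (auto simp: eventually_nhds)
    then have "open {z \<in> D. f z \<in> W}"
      by (subst open_subopen) simp
    then show "openin (top_of_set D) {z \<in> topspace (top_of_set D). f z \<in> W}"
      by (auto intro: open_subset)
  qed auto
qed

definition expanding_at ::
  "(complex \<Rightarrow> complex option) set \<Rightarrow> complex set \<Rightarrow> complex \<Rightarrow> complex option set \<Rightarrow> bool" where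
  "expanding_at F D z0 A \<longleftrightarrow>
     (\<forall>U K. open U \<and> z0 \<in> U \<and> U \<subseteq> D \<and> compactin Riemann_sphere K \<and> K \<subseteq> A \<longrightarrow>
        infinite {f \<in> F. K \<subseteq> f ` U})"

definition topologically_transitive_at ::
  "(complex \<Rightarrow> complex option) set \<Rightarrow> complex set \<Rightarrow> complex \<Rightarrow> bool" where
  "topologically_transitive_at F D z0 \<longleftrightarrow>
     (\<forall>U V. open U \<and> U \<subseteq> D \<and> z0 \<in> U \<and> openin Riemann_sphere V \<and> V \<noteq> {} \<longrightarrow>
        (\<exists>f\<in>F. f ` U \<inter> V \<noteq> {}))"

end

theory Submission
  imports Defs
begin

text \<open>
  A set with empty interior contains no nonempty open set, so every nonempty open target \<open>V\<close>
  has a point \<open>v\<close> outside \<open>E\<close>. The singleton \<open>{v}\<close> is compact, hence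
  expansion makes infinitely many members of the family, in particular at least one, attain
  \<open>v\<close> on the given neighbourhood. Transitivity is thus expansion tested on singletons.
\<close>

theorem theorem4p3:
  fixes F :: "(complex \<Rightarrow> complex option) set"
    and D :: "complex set"
    and z0 :: complex
    and E :: "complex option set"
  assumes "open D"
    and "F \<subseteq> meromorphic_maps D"
    and "z0 \<in> D"
    and "Riemann_sphere interior_of E = {}"
    and "expanding_at F D z0 (topspace Riemann_sphere - E)"
  shows "topologically_transitive_at F D z0"
  unfolding topologically_transitive_at_def
proof (intro allI impI, elim conjE)
  fix U V
  assume U: "open U" "U \<subseteq> D" "z0 \<in> U"
    and V: "openin Riemann_sphere V" "V \<noteq> {}"
  have "\<not> V \<subseteq> E"
    using interior_of_maximal[OF _ V(1)] V(2) assms(4) by blast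
  then obtain v where v: "v \<in> V" "v \<notin> E"
    by blast
  have "compactin Riemann_sphere {v}"
    by (simp add: topspace_Riemann_sphere del: topspace_Alexandroff_compactification)
  moreover have "{v} \<subseteq> topspace Riemann_sphere - E"
    using v(2) by (simp add: topspace_Riemann_sphere del: topspace_Alexandroff_compactification)
  ultimately have "infinite {f \<in> F. {v} \<subseteq> f ` U}"
    using assms(5) U unfolding expanding_at_def by blast
  then obtain f where "f \<in> F" "v \<in> f ` U"
    using not_finite_existsD by blast
  with v(1) show "\<exists>f\<in>F. f ` U \<inter> V \<noteq> {}"
    by blast
qed

end
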